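(* Let $(\mathcal{P}=P_1\oplus P_2,\odot,\{\!\!\{~,~\}\!\!\})$ be a proto-twilled Poisson algebra over a field $\mathbf{k}$ of characteristic $0$, with structure maps $\cdot_1,\cdot_2,\mu,\nu,h,\theta,\{~,~\}_1,\{~,~\}_2,\rho,\psi,H,\Theta$, and let $r:P_2\to P_1$ be a deformation map on it. Then the infinitesimal $r_1$ of any formal one-parameter deformation $r_t=\sum_{i\ge0}t^ir_i$ of $r$ is a $1$-cocycle in the cochain complex associated with $r$. Moreover, when $\psi=0$, the infinitesimals of equivalent formal one-parameter deformations of $r$ are cohomologous, i.e. they correspond to the same element in $H^1_{\mathrm{FGV}}((P_2)_r,P_1)$.
   Context: A Poisson algebra is a vector space with a commutative associative product and a Lie bracket such that the bracket satisfies the Leibniz rule $\{x,yz\}=\{x,y\}z+y\{x,z\}$. A proto-twilled Poisson algebra is a Poisson algebra $(\mathcal{P},\odot,\{\!\!\{~,~\}\!\!\})$ whose underlying vector space has a direct sum decomposition $\mathcal{P}=P_1\oplus P_2$ into subspaces (not necessarily subalgebras). Its structure maps are the (bi)linear maps $\cdot_1:P_1\times P_1\to P_1$, $\cdot_2:P_2\times P_2\to P_2$, $h:P_1\times P_1\to P_2$, $\theta:P_2\times P_2\to P_1$ (symmetric), $\{~,~\}_1:P_1\times P_1\to P_1$, $\{~,~\}_2:P_2\times P_2\to P_2$, $H:P_1\times P_1\to P_2$, $\Theta:P_2\times P_2\to P_1$ (antisymmetric), $\mu,\rho:P_1\to\mathrm{End}(P_2)$, $\nu,\psi:P_2\to\mathrm{End}(P_1)$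 uniquely determined by $$(x,u)\odot(y,v)=\big(x\cdot_1y+\nu_uy+\nu_vx+\theta(u,v),\ u\cdot_2v+\mu_xv+\mu_yu+h(x,y)\big),$$ $$\{\!\!\{(x,u),(y,v)\}\!\!\}=\big(\{x,y\}_1+\psi_uy-\psi_vx+\Theta(u,v),\ \{u,v\}_2+\rho_xv-\rho_yu+H(x,y)\big).$$ A linear map $r:P_2\to P_1$ is a deformation map if its graph $\{(r(u),u)\mid u\in P_2\}$ is a Poisson subalgebra of $\mathcal{P}$. Cohomology of $r$ in low degree: put $u\cdot_rv=u\cdot_2v+\mu_{r(u)}v+\mu_{r(v)}u+h(r(u),r(v))$, $\{u,v\}_r=\{u,v\}_2+\rho_{r(u)}v-\rho_{r(v)}u+H(r(u),r(v))$, a Poisson algebra structure on $P_2$ denoted $(P_2)_r$, with representation on $P_1$ given by $(\nu_r)_ux=\nu_ux+r(u)\cdot_1x-r(\mu_xu+h(r(u),x))$ and $(\psi_r)_ux=\psi_ux+\{r(u),x\}_1-r(-\rho_xu+H(r(u),x))$. The cochain complex associated with $r$ is the Flato-Gerstenhaber-Voronov complex of $(P_2)_r$ with coefficients in $(P_1,\nu_r,\psi_r)$. In degrees $0$ and $1$: $0$-cochains are elements $x\in P_1$, with $\delta^r_{\mathrm{FGV}}(x)(u)=(\psi_r)_ux$; $1$-cochains are linear maps $f:P_2\to P_1$, and $f$ is a $1$-cocycle iff for all $u,v\in P_2$, $f(u\cdot_rv)=(\nu_r)_uf(v)+(\nu_r)_vf(u)$ and $f(\{u,v\}_r)=(\psi_r)_uf(v)-(\psi_r)_vf(u)$.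 $H^1_{\mathrm{FGV}}((P_2)_r,P_1)$ is the space of $1$-cocycles modulo $\{\delta^r_{\mathrm{FGV}}(x)\mid x\in P_1\}$. A formal one-parameter deformation of $r$ is a formal power series $r_t=\sum_{i\ge0}t^ir_i\in\mathrm{Hom}(P_2,P_1)[[t]]$ with $r_0=r$ whose $\mathbf{k}[[t]]$-linear extension $r_t:P_2[[t]]\to P_1[[t]]$ is a deformation map in $\mathcal{P}[[t]]\cong P_1[[t]]\oplus P_2[[t]]$, with $\odot,\{\!\!\{~,~\}\!\!\}$ extended $\mathbf{k}[[t]]$-bilinearly. Its infinitesimal is $r_1$. A homomorphism from a deformation map $r$ to a deformation map $r'$ (in the same proto-twilled Poisson algebra) is a pair of linear maps $\varphi_1:P_1\to P_1$, $\varphi_2:P_2\to P_2$ such that $\varphi_1\oplus\varphi_2$ is a Poisson algebra homomorphism of $P_1\oplus P_2$ and $\varphi_1\circ r=r'\circ\varphi_2$ (similarly over $\mathbf{k}[[t]]$). Two formal one-parameter deformations $r_t$, $r'_t$ of $r$ are equivalent if there exist $x_0\in P_1$ and linear maps $\varphi_{1,i}:P_1\to P_1$, $\varphi_{2,i}:P_2\to P_2$ ($i\ge2$) such that the pair $$\varphi_{1,t}=\mathrm{id}_{P_1}+t\{x_0,-\}_1+\sum_{i\ge2}t^i\varphi_{1,i},\qquad \varphi_{2,t}=\mathrm{id}_{P_2}+t\big(\rho_{x_0}+H(x_0,r(-))\big)+\sum_{i\ge2}t^i\varphi_{2,i}$$ is a homomorphism of deformation maps (over $\mathbf{k}[[t]]$,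 in $\mathcal{P}[[t]]$) from $r_t$ to $r'_t$. *)

theory Defs
  imports "HOL-Analysis.Product_Vector" "HOL-Computational_Algebra.Formal_Power_Series"
begin

section \<open>Poisson algebras\<close>

text \<open>
  Scalars range over a commutative ring, because the same notions are used over the base field
  and over the ring of formal power series. Over a field, \<^const>\<open>module\<close> and
  \<^const>\<open>module_hom\<close> are vector spaces and linear maps. As characteristic 2 is not excluded
  at this level, the Lie bracket is required to be alternating.
\<close>

locale poisson_algebra = module smul
  for smul :: "'k::comm_ring_1 \<Rightarrow> 'p::ab_group_add \<Rightarrow> 'p" +
  fixes prd :: "'p \<Rightarrow> 'p \<Rightarrow> 'p"
    and brk :: "'p \<Rightarrow> 'p \<Rightarrow> 'p"
  assumes mult_linear_left: "module_hom smul smul (\<lambda>x. prd x y)"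
    and mult_linear_right: "module_hom smul smul (prd x)"
    and mult_commute: "prd x y = prd y x"
    and mult_assoc: "prd (prd x y) z = prd x (prd y z)"
    and bracket_linear_left: "module_hom smul smul (\<lambda>x. brk x y)"
    and bracket_linear_right: "module_hom smul smul (brk x)"
    and bracket_self: "brk x x = 0"
    and jacobi: "brk x (brk y z) + brk y (brk z x) + brk z (brk x y) = 0"
    and leibniz: "brk x (prd y z) = prd (brk x y) z + prd y (brk x z)"

definition poisson_subalgebra ::
  "('k::comm_ring_1 \<Rightarrow> 'p::ab_group_add \<Rightarrow> 'p) \<Rightarrow> ('p \<Rightarrow> 'p \<Rightarrow> 'p) \<Rightarrow> ('p \<Rightarrow> 'p \<Rightarrow> 'p) \<Rightarrow> 'p set \<Rightarrow> bool"
  where "poisson_subalgebra smul prd brk S \<longleftrightarrow>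
    module.subspace smul S \<and>
    (\<forall>x\<in>S. \<forall>y\<in>S. prd x y \<in> S) \<and> (\<forall>x\<in>S. \<forall>y\<in>S. brk x y \<in> S)"


section \<open>Proto-twilled Poisson algebras\<close>

text \<open>
  The decomposition into two subspaces is the external direct sum of two modules (the first and
  the second factor of a product type), so elements are pairs \<open>(x, u)\<close>. Neither summand is
  required to be a subalgebra.
\<close>

record ('k, 'a, 'b) ptp =
  scale1 :: "'k \<Rightarrow> 'a \<Rightarrow> 'a"
  scale2 :: "'k \<Rightarrow> 'b \<Rightarrow> 'b"
  pmult :: "'a \<times> 'b \<Rightarrow> 'a \<times> 'b \<Rightarrow> 'a \<times> 'b"
  pbracket :: "'a \<times> 'b \<Rightarrow> 'a \<times> 'b \<Rightarrow> 'a \<times> 'b"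

definition pscale ::
  "('k::comm_ring_1, 'a::ab_group_add, 'b::ab_group_add) ptp \<Rightarrow> 'k \<Rightarrow> 'a \<times> 'b \<Rightarrow> 'a \<times> 'b"
  where "pscale P = module_prod.scale (scale1 P) (scale2 P)"

definition proto_twilled_poisson ::
  "('k::comm_ring_1, 'a::ab_group_add, 'b::ab_group_add) ptp \<Rightarrow> bool"
  where "proto_twilled_poisson P \<longleftrightarrow>
    module (scale1 P) \<and> module (scale2 P) \<and>
    poisson_algebra (pscale P) (pmult P) (pbracket P)"

text \<open>The structure maps are the components of the two operations on the summands; see
  \<open>pmult_decomp\<close> and \<open>pbracket_decomp\<close> below.\<close>

definition dot1 :: "('k, 'a, 'b::zero) ptp \<Rightarrow> 'a \<Rightarrow> 'a \<Rightarrow> 'a"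
  where "dot1 P x y = fst (pmult P (x, 0) (y, 0))"

definition hmap :: "('k, 'a, 'b::zero) ptp \<Rightarrow> 'a \<Rightarrow> 'a \<Rightarrow> 'b"
  where "hmap P x y = snd (pmult P (x, 0) (y, 0))"

definition dot2 :: "('k, 'a::zero, 'b) ptp \<Rightarrow> 'b \<Rightarrow> 'b \<Rightarrow> 'b"
  where "dot2 P u v = snd (pmult P (0, u) (0, v))"

definition theta :: "('k, 'a::zero, 'b) ptp \<Rightarrow> 'b \<Rightarrow> 'b \<Rightarrow> 'a"
  where "theta P u v = fst (pmult P (0, u) (0, v))"

definition mu :: "('k, 'a::zero, 'b::zero) ptp \<Rightarrow> 'a \<Rightarrow> 'b \<Rightarrow> 'b"
  where "mu P x v = snd (pmult P (x, 0) (0, v))"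

definition nu :: "('k, 'a::zero, 'b::zero) ptp \<Rightarrow> 'b \<Rightarrow> 'a \<Rightarrow> 'a"
  where "nu P u y = fst (pmult P (0, u) (y, 0))"

definition br1 :: "('k, 'a, 'b::zero) ptp \<Rightarrow> 'a \<Rightarrow> 'a \<Rightarrow> 'a"
  where "br1 P x y = fst (pbracket P (x, 0) (y, 0))"

definition Hmap :: "('k, 'a, 'b::zero) ptp \<Rightarrow> 'a \<Rightarrow> 'a \<Rightarrow> 'b"
  where "Hmap P x y = snd (pbracket P (x, 0) (y, 0))"

definition br2 :: "('k, 'a::zero, 'b) ptp \<Rightarrow> 'b \<Rightarrow> 'b \<Rightarrow> 'b"
  where "br2 P u v = snd (pbracket P (0, u) (0, v))"

definition Theta :: "('k, 'a::zero, 'b) ptp \<Rightarrow> 'b \<Rightarrow> 'b \<Rightarrow> 'a"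
  where "Theta P u v = fst (pbracket P (0, u) (0, v))"

definition rho :: "('k, 'a::zero, 'b::zero) ptp \<Rightarrow> 'a \<Rightarrow> 'b \<Rightarrow> 'b"
  where "rho P x v = snd (pbracket P (x, 0) (0, v))"

definition psi :: "('k, 'a::zero, 'b::zero) ptp \<Rightarrow> 'b \<Rightarrow> 'a \<Rightarrow> 'a"
  where "psi P u y = fst (pbracket P (0, u) (y, 0))"

context poisson_algebra
begin

lemma mult_add_left: "prd (x + y) z = prd x z + prd y z"
  using mult_linear_left[of z] by (simp add: module_hom_iff)

lemma mult_add_right: "prd z (x + y) = prd z x + prd z y"
  using mult_linear_right[of z] by (simp add: module_hom_iff)

lemma bracket_add_left: "brk (x + y) z = brk x z + brk y z"
  using bracket_linear_left[of z] by (simp add: module_hom_iff)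

lemma bracket_add_right: "brk z (x + y) = brk z x + brk z y"
  using bracket_linear_right[of z] by (simp add: module_hom_iff)

lemma bracket_antisym: "brk x y = - brk y x"
proof -
  have "brk (x + y) (x + y) = (brk x x + brk y x) + (brk x y + brk y y)"
    by (simp only: bracket_add_left bracket_add_right)
  then have "brk x y + brk y x = 0"
    by (simp add: bracket_self add.commute)
  then show ?thesis by (simp add: eq_neg_iff_add_eq_0)
qed

end

lemma pmult_decomp:
  assumes "proto_twilled_poisson P"
  shows "pmult P (x, u) (y, v) =
    (dot1 P x y + nu P u y + nu P v x + theta P u v,
     dot2 P u v + mu P x v + mu P y u + hmap P x y)"
proof -
  interpret poisson_algebra "pscale P" "pmult P" "pbracket P"
    using assms by (simp add: proto_twilled_poisson_def)
  have "pmult P (x, u) (y, v) = pmult P ((x, 0) + (0, u)) ((y, 0) + (0, v))"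
    by simp
  also have "\<dots> = pmult P (x, 0) (y, 0) + pmult P (0, u) (y, 0)
      + (pmult P (x, 0) (0, v) + pmult P (0, u) (0, v))"
    by (simp only: mult_add_left mult_add_right)
  finally show ?thesis
    using mult_commute[of "(0, v)" "(x, 0)"] mult_commute[of "(0, u)" "(y, 0)"]
    by (simp add: prod_eq_iff dot1_def nu_def theta_def dot2_def mu_def hmap_def ac_simps)
qed

lemma pbracket_decomp:
  assumes "proto_twilled_poisson P"
  shows "pbracket P (x, u) (y, v) =
    (br1 P x y + psi P u y - psi P v x + Theta P u v,
     br2 P u v + rho P x v - rho P y u + Hmap P x y)"
proof -
  interpret poisson_algebra "pscale P" "pmult P" "pbracket P"
    using assms by (simp add: proto_twilled_poisson_def)
  have "pbracket P (x, u) (y, v) = pbracket P ((x, 0) + (0, u)) ((y, 0) + (0, v))"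
    by simp
  also have "\<dots> = pbracket P (x, 0) (y, 0) + pbracket P (0, u) (y, 0)
      + (pbracket P (x, 0) (0, v) + pbracket P (0, u) (0, v))"
    by (simp only: bracket_add_left bracket_add_right)
  finally show ?thesis
    using bracket_antisym[of "(0, v)" "(x, 0)"] bracket_antisym[of "(0, u)" "(y, 0)"]
    by (simp add: prod_eq_iff br1_def psi_def Theta_def br2_def rho_def Hmap_def ac_simps)
qed


section \<open>Deformation maps\<close>

definition deformation_map ::
  "('k::comm_ring_1, 'a::ab_group_add, 'b::ab_group_add) ptp \<Rightarrow> ('b \<Rightarrow> 'a) \<Rightarrow> bool"
  where "deformation_map P r \<longleftrightarrow>
    module_hom (scale2 P) (scale1 P) r \<and>
    poisson_subalgebra (pscale P) (pmult P) (pbracket P) {(r u, u) | u. True}"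

definition deformation_map_hom ::
  "('k::comm_ring_1, 'a::ab_group_add, 'b::ab_group_add) ptp \<Rightarrow> ('b \<Rightarrow> 'a) \<Rightarrow> ('b \<Rightarrow> 'a) \<Rightarrow>
    ('a \<Rightarrow> 'a) \<Rightarrow> ('b \<Rightarrow> 'b) \<Rightarrow> bool"
  where "deformation_map_hom P r r' \<phi>1 \<phi>2 \<longleftrightarrow>
    module_hom (scale1 P) (scale1 P) \<phi>1 \<and>
    module_hom (scale2 P) (scale2 P) \<phi>2 \<and>
    (\<forall>z w. map_prod \<phi>1 \<phi>2 (pmult P z w) = pmult P (map_prod \<phi>1 \<phi>2 z) (map_prod \<phi>1 \<phi>2 w)) \<and>
    (\<forall>z w. map_prod \<phi>1 \<phi>2 (pbracket P z w) =
      pbracket P (map_prod \<phi>1 \<phi>2 z) (map_prod \<phi>1 \<phi>2 w)) \<and>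
    \<phi>1 \<circ> r = r' \<circ> \<phi>2"


section \<open>Cohomology of a deformation map in degree one\<close>

definition dot_r :: "('k, 'a::ab_group_add, 'b::ab_group_add) ptp \<Rightarrow> ('b \<Rightarrow> 'a) \<Rightarrow> 'b \<Rightarrow> 'b \<Rightarrow> 'b"
  where "dot_r P r u v = dot2 P u v + mu P (r u) v + mu P (r v) u + hmap P (r u) (r v)"

definition br_r :: "('k, 'a::ab_group_add, 'b::ab_group_add) ptp \<Rightarrow> ('b \<Rightarrow> 'a) \<Rightarrow> 'b \<Rightarrow> 'b \<Rightarrow> 'b"
  where "br_r P r u v = br2 P u v + rho P (r u) v - rho P (r v) u + Hmap P (r u) (r v)"

definition nu_r :: "('k, 'a::ab_group_add, 'b::ab_group_add) ptp \<Rightarrow> ('b \<Rightarrow> 'a) \<Rightarrow> 'b \<Rightarrow> 'a \<Rightarrow> 'a"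
  where "nu_r P r u x = nu P u x + dot1 P (r u) x - r (mu P x u + hmap P (r u) x)"

definition psi_r :: "('k, 'a::ab_group_add, 'b::ab_group_add) ptp \<Rightarrow> ('b \<Rightarrow> 'a) \<Rightarrow> 'b \<Rightarrow> 'a \<Rightarrow> 'a"
  where "psi_r P r u x = psi P u x + br1 P (r u) x - r (- rho P x u + Hmap P (r u) x)"

definition delta0 :: "('k, 'a::ab_group_add, 'b::ab_group_add) ptp \<Rightarrow> ('b \<Rightarrow> 'a) \<Rightarrow> 'a \<Rightarrow> 'b \<Rightarrow> 'a"
  where "delta0 P r x = (\<lambda>u. psi_r P r u x)"

definition cocycles1 ::
  "('k::comm_ring_1, 'a::ab_group_add, 'b::ab_group_add) ptp \<Rightarrow> ('b \<Rightarrow> 'a) \<Rightarrow> ('b \<Rightarrow> 'a) set"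
  where "cocycles1 P r = {f. module_hom (scale2 P) (scale1 P) f \<and>
    (\<forall>u v. f (dot_r P r u v) = nu_r P r u (f v) + nu_r P r v (f u)) \<and>
    (\<forall>u v. f (br_r P r u v) = psi_r P r u (f v) - psi_r P r v (f u))}"

definition cohomologous_rel ::
  "('k::comm_ring_1, 'a::ab_group_add, 'b::ab_group_add) ptp \<Rightarrow> ('b \<Rightarrow> 'a) \<Rightarrow>
    (('b \<Rightarrow> 'a) \<times> ('b \<Rightarrow> 'a)) set"
  where "cohomologous_rel P r = {(f, g). f \<in> cocycles1 P r \<and> g \<in> cocycles1 P r \<and>
    (\<lambda>u. f u - g u) \<in> range (delta0 P r)}"

definition H1_FGV ::
  "('k::comm_ring_1, 'a::ab_group_add, 'b::ab_group_add) ptp \<Rightarrow> ('b \<Rightarrow> 'a) \<Rightarrow> ('b \<Rightarrow> 'a) set set"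
  where "H1_FGV P r = cocycles1 P r // cohomologous_rel P r"

definition H1_class ::
  "('k::comm_ring_1, 'a::ab_group_add, 'b::ab_group_add) ptp \<Rightarrow> ('b \<Rightarrow> 'a) \<Rightarrow> ('b \<Rightarrow> 'a) \<Rightarrow> ('b \<Rightarrow> 'a) set"
  where "H1_class P r f = cohomologous_rel P r `` {f}"

lemma delta0_add:
  assumes P: "proto_twilled_poisson P" and r: "module_hom (scale2 P) (scale1 P) r"
  shows "delta0 P r (x + y) u = delta0 P r x u + delta0 P r y u"
proof -
  interpret poisson_algebra "pscale P" "pmult P" "pbracket P"
    using P by (simp add: proto_twilled_poisson_def)
  interpret r: module_hom "scale2 P" "scale1 P" r by (rule r)
  have 1: "pbracket P z (x + y, 0) = pbracket P z (x, 0) + pbracket P z (y, 0)" for z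
    using bracket_add_right[of z "(x, 0)" "(y, 0)"] by simp
  have 2: "pbracket P (x + y, 0) z = pbracket P (x, 0) z + pbracket P (y, 0) z" for z
    using bracket_add_left[of "(x, 0)" "(y, 0)" z] by simp
  show ?thesis
    by (simp add: delta0_def psi_r_def psi_def br1_def rho_def Hmap_def 1 2 r.add r.neg r.diff
        algebra_simps)
qed

lemma equiv_cohomologous_rel:
  assumes P: "proto_twilled_poisson P" and r: "module_hom (scale2 P) (scale1 P) r"
  shows "equiv (cocycles1 P r) (cohomologous_rel P r)"
proof -
  note add = delta0_add[OF P r]
  have zero: "delta0 P r 0 u = 0" for u
    using add[of 0 0 u] by simp
  have neg: "delta0 P r (- x) u = - delta0 P r x u" for x u
    using add[of x "- x" u] zero[of u] by (simp add: eq_neg_iff_add_eq_0 add.commute)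
  have B: "f \<in> range (delta0 P r) \<longleftrightarrow> (\<exists>x. \<forall>u. f u = delta0 P r x u)" for f
    by (auto simp: fun_eq_iff image_iff)
  show ?thesis
  proof (rule equivI)
    show "cohomologous_rel P r \<subseteq> cocycles1 P r \<times> cocycles1 P r"
      by (auto simp: cohomologous_rel_def)
    show "refl_on (cocycles1 P r) (cohomologous_rel P r)"
      by (auto simp: refl_on_def cohomologous_rel_def B zero intro: exI[of _ 0])
    show "sym (cohomologous_rel P r)"
    proof (rule symI)
      fix f g assume "(f, g) \<in> cohomologous_rel P r"
      then obtain x where *: "f \<in> cocycles1 P r" "g \<in> cocycles1 P r" "\<And>u. f u - g u = delta0 P r x u"
        by (auto simp: cohomologous_rel_def B)
      have "g u - f u = delta0 P r (- x) u" for u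
        using *(3)[of u] by (simp add: neg algebra_simps)
      then show "(g, f) \<in> cohomologous_rel P r"
        using * by (auto simp: cohomologous_rel_def B)
    qed
    show "trans (cohomologous_rel P r)"
    proof (rule transI)
      fix f g h assume "(f, g) \<in> cohomologous_rel P r" "(g, h) \<in> cohomologous_rel P r"
      then obtain x y where *: "f \<in> cocycles1 P r" "h \<in> cocycles1 P r"
          "\<And>u. f u - g u = delta0 P r x u" "\<And>u. g u - h u = delta0 P r y u"
        by (auto simp: cohomologous_rel_def B)
      have "f u - h u = delta0 P r (x + y) u" for u
        using *(3,4)[of u] by (simp add: add algebra_simps)
      then show "(f, h) \<in> cohomologous_rel P r"
        using * by (auto simp: cohomologous_rel_def B)
    qed
  qed
qed


section \<open>Formal power series and formal deformations\<close>

text \<open>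
  The extension of a biadditive map to formal power series (Cauchy product). It yields the scalar
  action of \<open>k[[t]]\<close>, the \<open>k[[t]]\<close>-bilinear extension of the operations and, for the evaluation
  pairing, the \<open>k[[t]]\<close>-linear extension \<open>fps_lin\<close> of a power series of linear maps.
\<close>

definition fps_bilin :: "('a \<Rightarrow> 'b \<Rightarrow> 'c::comm_monoid_add) \<Rightarrow> 'a fps \<Rightarrow> 'b fps \<Rightarrow> 'c fps"
  where "fps_bilin f X Y = Abs_fps (\<lambda>n. \<Sum>i\<le>n. f (fps_nth X i) (fps_nth Y (n - i)))"

definition fps_lin :: "('a \<Rightarrow> 'b::comm_monoid_add) fps \<Rightarrow> 'a fps \<Rightarrow> 'b fps"
  where "fps_lin F X = fps_bilin (\<lambda>f x. f x) F X"

text \<open>The identification of \<open>P[[t]]\<close> with \<open>P1[[t]] \<oplus> P2[[t]]\<close>.\<close>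

definition fps_zip :: "'a fps \<times> 'b fps \<Rightarrow> ('a \<times> 'b) fps"
  where "fps_zip Z = Abs_fps (\<lambda>n. (fps_nth (fst Z) n, fps_nth (snd Z) n))"

definition fps_unzip :: "('a \<times> 'b) fps \<Rightarrow> 'a fps \<times> 'b fps"
  where "fps_unzip W = (Abs_fps (\<lambda>n. fst (fps_nth W n)), Abs_fps (\<lambda>n. snd (fps_nth W n)))"

definition fps_ptp ::
  "('k::comm_ring_1, 'a::ab_group_add, 'b::ab_group_add) ptp \<Rightarrow> ('k fps, 'a fps, 'b fps) ptp"
  where "fps_ptp P = \<lparr>
    scale1 = fps_bilin (scale1 P),
    scale2 = fps_bilin (scale2 P),
    pmult = (\<lambda>Z W. fps_unzip (fps_bilin (pmult P) (fps_zip Z) (fps_zip W))),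
    pbracket = (\<lambda>Z W. fps_unzip (fps_bilin (pbracket P) (fps_zip Z) (fps_zip W)))\<rparr>"

lemma fps_nth_bilin: "fps_nth (fps_bilin f X Y) n = (\<Sum>i\<le>n. f (fps_nth X i) (fps_nth Y (n - i)))"
  by (simp add: fps_bilin_def)

lemma fps_nth_zip [simp]: "fps_nth (fps_zip Z) n = (fps_nth (fst Z) n, fps_nth (snd Z) n)"
  by (simp add: fps_zip_def)

lemma fps_zip_unzip [simp]: "fps_zip (fps_unzip W) = W"
  by (simp add: fps_eq_iff fps_unzip_def)

lemma fps_unzip_zip [simp]: "fps_unzip (fps_zip Z) = Z"
  by (simp add: prod_eq_iff fps_eq_iff fps_unzip_def)

lemma fps_zip_inject: "fps_zip Z = fps_zip W \<longleftrightarrow> Z = W"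
  by (metis fps_unzip_zip)

lemma fps_zip_add: "fps_zip (Z + W) = fps_zip Z + fps_zip W"
  by (simp add: fps_eq_iff)

lemma fps_zip_0: "fps_zip 0 = 0"
  by (simp add: fps_eq_iff zero_prod_def)

lemma pair_sum_eq_triple:
  fixes g :: "nat \<Rightarrow> nat \<Rightarrow> nat \<Rightarrow> 'c::comm_monoid_add"
  shows "(\<Sum>i\<le>n. \<Sum>j\<le>i. g j (i - j) (n - i)) = (\<Sum>(i, j, k) | i + j + k = n. g i j k)"
    and "(\<Sum>i\<le>n. \<Sum>j\<le>n - i. g i j (n - i - j)) = (\<Sum>(i, j, k) | i + j + k = n. g i j k)"
proof -
  show "(\<Sum>i\<le>n. \<Sum>j\<le>i. g j (i - j) (n - i)) = (\<Sum>(i, j, k) | i + j + k = n. g i j k)"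
    by (subst sum.Sigma, simp, simp)
       (rule sum.reindex_bij_witness[where
          i = "\<lambda>(i, j, k). (i + j, i)" and j = "\<lambda>(i, j). (j, i - j, n - i)"], auto)
  show "(\<Sum>i\<le>n. \<Sum>j\<le>n - i. g i j (n - i - j)) = (\<Sum>(i, j, k) | i + j + k = n. g i j k)"
    by (subst sum.Sigma, simp, simp)
       (rule sum.reindex_bij_witness[where
          i = "\<lambda>(i, j, k). (i, j)" and j = "\<lambda>(i, j). (i, j, n - i - j)"], auto)
qed

lemma additive_sum:
  fixes f :: "'a::ab_group_add \<Rightarrow> 'b::ab_group_add"
  assumes "\<And>x y. f (x + y) = f x + f y"
  shows "f (sum g A) = (\<Sum>i\<in>A. f (g i))"
proof -
  have "f 0 = 0" using assms[of 0 0] by simp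
  then show ?thesis by (induction A rule: infinite_finite_induct) (simp_all add: assms)
qed

lemma fps_bilin_left:
  fixes f :: "'a::ab_group_add \<Rightarrow> 'b \<Rightarrow> 'c::ab_group_add"
  assumes "\<And>x y z. f (x + y) z = f x z + f y z"
  shows "fps_nth (fps_bilin f (fps_bilin g X Y) Z) n =
    (\<Sum>(i, j, k) | i + j + k = n. f (g (fps_nth X i) (fps_nth Y j)) (fps_nth Z k))"
  by (simp add: fps_nth_bilin additive_sum[where f = "\<lambda>x. f x _", OF assms]
      pair_sum_eq_triple(1)[of "\<lambda>i j k. f (g (fps_nth X i) (fps_nth Y j)) (fps_nth Z k)", symmetric])

lemma fps_bilin_right:
  fixes f :: "'a \<Rightarrow> 'b::ab_group_add \<Rightarrow> 'c::ab_group_add"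
  assumes "\<And>x y z. f z (x + y) = f z x + f z y"
  shows "fps_nth (fps_bilin f X (fps_bilin g Y Z)) n =
    (\<Sum>(i, j, k) | i + j + k = n. f (fps_nth X i) (g (fps_nth Y j) (fps_nth Z k)))"
  by (simp add: fps_nth_bilin additive_sum[where f = "f _", OF assms]
      pair_sum_eq_triple(2)[of "\<lambda>i j k. f (fps_nth X i) (g (fps_nth Y j) (fps_nth Z k))", symmetric])

lemma triple_sum_rotate:
  fixes g :: "nat \<Rightarrow> nat \<Rightarrow> nat \<Rightarrow> 'c::comm_monoid_add"
  shows "(\<Sum>(i, j, k) | i + j + k = n. g i j k) = (\<Sum>(i, j, k) | i + j + k = n. g j k i)"
  by (rule sum.reindex_bij_witness[where
        i = "\<lambda>(i, j, k). (j, k, i)" and j = "\<lambda>(i, j, k). (k, i, j)"]) auto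

lemma triple_sum_swap:
  fixes g :: "nat \<Rightarrow> nat \<Rightarrow> nat \<Rightarrow> 'c::comm_monoid_add"
  shows "(\<Sum>(i, j, k) | i + j + k = n. g i j k) = (\<Sum>(i, j, k) | i + j + k = n. g j i k)"
  by (rule sum.reindex_bij_witness[where
        i = "\<lambda>(i, j, k). (j, i, k)" and j = "\<lambda>(i, j, k). (j, i, k)"]) auto

lemma fps_bilin_commute:
  assumes "\<And>x y. f x y = g y x"
  shows "fps_bilin f X Y = fps_bilin g Y X"
proof (rule fps_ext)
  fix n
  show "fps_nth (fps_bilin f X Y) n = fps_nth (fps_bilin g Y X) n"
    unfolding fps_nth_bilin assms
    by (rule sum.reindex_bij_witness[where i = "\<lambda>i. n - i" and j = "\<lambda>i. n - i"]) auto
qed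

lemma fps_bilin_add_left:
  assumes "\<And>x y z. f (x + y) z = f x z + f y z"
  shows "fps_bilin f (X + Y) Z = fps_bilin f X Z + fps_bilin f Y Z"
  by (simp add: fps_eq_iff fps_nth_bilin assms sum.distrib)

lemma fps_bilin_add_right:
  assumes "\<And>x y z. f z (x + y) = f z x + f z y"
  shows "fps_bilin f Z (X + Y) = fps_bilin f Z X + fps_bilin f Z Y"
  by (simp add: fps_eq_iff fps_nth_bilin assms sum.distrib)

lemma module_fps_bilin:
  assumes "module s"
  shows "module (fps_bilin s)"
proof -
  interpret module s by (rule assms)
  show ?thesis
  proof
    fix a b :: "'a fps" and x y :: "'b fps"
    show "fps_bilin s a (x + y) = fps_bilin s a x + fps_bilin s a y"
      by (rule fps_bilin_add_right) (rule scale_right_distrib)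
    show "fps_bilin s (a + b) x = fps_bilin s a x + fps_bilin s b x"
      by (rule fps_bilin_add_left) (rule scale_left_distrib)
    have m: "a * b = fps_bilin (*) a b"
      by (simp add: fps_eq_iff fps_mult_nth fps_nth_bilin atLeast0AtMost)
    show "fps_bilin s a (fps_bilin s b x) = fps_bilin s (a * b) x"
      unfolding m by (rule fps_ext)
        (subst fps_bilin_left, rule scale_left_distrib, subst fps_bilin_right,
          rule scale_right_distrib, simp)
    show "fps_bilin s 1 x = x"
    proof (rule fps_ext)
      fix n
      have "fps_nth (fps_bilin s 1 x) n = (\<Sum>i\<le>n. if i = 0 then fps_nth x n else 0)"
        unfolding fps_nth_bilin by (rule sum.cong) auto
      then show "fps_nth (fps_bilin s 1 x) n = fps_nth x n"
        by simp
    qed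
  qed
qed

lemma fps_bilin_self:
  assumes add: "\<And>x y z. f (x + y) z = f x z + f y z" "\<And>x y z. f z (x + y) = f z x + f z y"
    and self: "\<And>x. f x x = (0 :: 'c::ab_group_add)"
  shows "fps_bilin f X X = 0"
proof (rule fps_ext)
  fix n
  have anti: "f x y = - f y x" for x y
  proof -
    have "f (x + y) (x + y) = (f x x + f y x) + (f x y + f y y)"
      by (simp only: add)
    then have "f x y + f y x = 0"
      by (simp add: self add.commute)
    then show ?thesis by (simp add: eq_neg_iff_add_eq_0)
  qed
  let ?g = "\<lambda>i. f (fps_nth X i) (fps_nth X (n - i))"
  have flip: "?g (n - i) = - ?g i" if "i \<le> n" for i
    using that anti[of "fps_nth X (n - i)"] by simp
  let ?A = "{i. 2 * i < n}" and ?B = "{i. i \<le> n \<and> n < 2 * i}" and ?C = "{i. 2 * i = n}"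
  have "{..n} = ?A \<union> (?B \<union> ?C)" by auto
  moreover have "finite ?A" "finite ?B" "finite ?C"
    by (rule finite_subset[of _ "{..n}"]; auto)+
  ultimately have "sum ?g {..n} = sum ?g ?A + (sum ?g ?B + sum ?g ?C)"
    by (simp, subst sum.union_disjoint, auto, subst sum.union_disjoint, auto)
  moreover have "sum ?g ?C = 0"
  proof (rule sum.neutral, safe)
    fix i assume "n = 2 * i"
    then have "n - i = i" by simp
    then show "f (fps_nth X i) (fps_nth X (2 * i - i)) = 0" by (simp add: self)
  qed
  moreover have "sum ?g ?B = (\<Sum>i\<in>?A. - ?g i)"
    by (rule sum.reindex_bij_witness[where i = "\<lambda>i. n - i" and j = "\<lambda>i. n - i"])
       (auto simp: flip anti[of "fps_nth X (n - _)"] self)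
  ultimately show "fps_nth (fps_bilin f X X) n = fps_nth 0 n"
    by (simp add: fps_nth_bilin sum_negf)
qed

text \<open>The power series extension is again a proto-twilled Poisson algebra, now over \<open>k[[t]]\<close>.\<close>

lemma proto_twilled_poisson_fps_ptp:
  assumes P: "proto_twilled_poisson P"
  shows "proto_twilled_poisson (fps_ptp P)"
proof -
  interpret poisson_algebra "pscale P" "pmult P" "pbracket P"
    using P by (simp add: proto_twilled_poisson_def)
  have mods: "module (scale1 P)" "module (scale2 P)"
    using P by (auto simp: proto_twilled_poisson_def)
  have fmods: "module (scale1 (fps_ptp P))" "module (scale2 (fps_ptp P))"
    using mods by (simp_all add: fps_ptp_def module_fps_bilin)
  have ps: "pscale P c z = (scale1 P c (fst z), scale2 P c (snd z))" for c z
    using mods by (simp add: pscale_def module_prod.scale_def module_prod_def module_pair_def)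
  have fps: "pscale (fps_ptp P) c Z = (fps_bilin (scale1 P) c (fst Z), fps_bilin (scale2 P) c (snd Z))"
    for c Z
    using fmods by (simp add: pscale_def module_prod.scale_def module_prod_def module_pair_def)
      (simp add: fps_ptp_def)
  have zs: "fps_zip (pscale (fps_ptp P) c Z) = fps_bilin (pscale P) c (fps_zip Z)" for c Z
    by (simp add: fps_eq_iff fps fps_nth_bilin ps prod_eq_iff fst_sum snd_sum)
  have zm: "fps_zip (pmult (fps_ptp P) Z W) = fps_bilin (pmult P) (fps_zip Z) (fps_zip W)" for Z W
    by (simp add: fps_ptp_def)
  have zb: "fps_zip (pbracket (fps_ptp P) Z W) = fps_bilin (pbracket P) (fps_zip Z) (fps_zip W)"
    for Z W
    by (simp add: fps_ptp_def)
  interpret F: module_prod "scale1 (fps_ptp P)" "scale2 (fps_ptp P)"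
    using fmods by (simp add: module_prod_def module_pair_def)
  have fmod: "module (pscale (fps_ptp P))"
    unfolding pscale_def by unfold_locales
  have lin: "fps_bilin f (fps_bilin (pscale P) c X) Y = fps_bilin (pscale P) c (fps_bilin f X Y)"
    if "\<And>y. module_hom (pscale P) (pscale P) (\<lambda>x. f x y)" for f c X Y
  proof (rule fps_ext)
    fix n
    have 1: "f (x + y) z = f x z + f y z" "f (pscale P k x) z = pscale P k (f x z)" for k x y z
      using that[of z] unfolding module_hom_iff by blast+
    show "fps_nth (fps_bilin f (fps_bilin (pscale P) c X) Y) n =
        fps_nth (fps_bilin (pscale P) c (fps_bilin f X Y)) n"
      by (subst fps_bilin_left, rule 1, subst fps_bilin_right, rule scale_right_distrib)
         (simp add: 1)
  qed
  note zips = fps_zip_inject[symmetric] zs zm zb fps_zip_add fps_zip_0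
  note adds = mult_add_left mult_add_right bracket_add_left bracket_add_right
  have mcomm: "fps_bilin (pmult P) X Y = fps_bilin (pmult P) Y X" for X Y
    by (rule fps_bilin_commute) (rule mult_commute)
  have banti: "fps_bilin (pbracket P) X Y = - fps_bilin (pbracket P) Y X" for X Y
  proof -
    have "fps_bilin (pbracket P) X Y = fps_bilin (\<lambda>y x. - pbracket P y x) Y X"
      by (rule fps_bilin_commute) (rule bracket_antisym)
    then show ?thesis by (simp add: fps_eq_iff fps_nth_bilin sum_negf)
  qed
  have "poisson_algebra (pscale (fps_ptp P)) (pmult (fps_ptp P)) (pbracket (fps_ptp P))"
  proof (rule poisson_algebra.intro[OF fmod], rule poisson_algebra_axioms.intro)
    fix X Y Z
    show left: "module_hom (pscale (fps_ptp P)) (pscale (fps_ptp P)) (\<lambda>x. pmult (fps_ptp P) x Y)"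
      for Y
      by (simp add: module_hom_iff fmod zips lin[OF mult_linear_left] fps_bilin_add_left mult_add_left)
    show comm: "pmult (fps_ptp P) X Y = pmult (fps_ptp P) Y X" for X Y
      by (simp add: zips mcomm)
    show "module_hom (pscale (fps_ptp P)) (pscale (fps_ptp P)) (pmult (fps_ptp P) X)"
      using left[of X] by (simp add: comm[of _ X])
    show bleft: "module_hom (pscale (fps_ptp P)) (pscale (fps_ptp P))
        (\<lambda>x. pbracket (fps_ptp P) x Y)" for Y
      by (simp add: module_hom_iff fmod zips lin[OF bracket_linear_left] fps_bilin_add_left
          bracket_add_left)
    have anti: "pbracket (fps_ptp P) X = (\<lambda>x. - pbracket (fps_ptp P) x X)"
    proof
      fix Z
      have "pbracket (fps_ptp P) X Z + pbracket (fps_ptp P) Z X = 0"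
        using banti[of "fps_zip X" "fps_zip Z"] by (simp add: zips)
      then show "pbracket (fps_ptp P) X Z = - pbracket (fps_ptp P) Z X"
        by (simp add: eq_neg_iff_add_eq_0)
    qed
    show "module_hom (pscale (fps_ptp P)) (pscale (fps_ptp P)) (pbracket (fps_ptp P) X)"
      unfolding anti
      by (rule module_pair.module_hom_neg) (simp_all add: module_pair_def fmod bleft)
    show "pbracket (fps_ptp P) X X = 0"
      by (simp add: zips fps_bilin_self adds bracket_self)
    show "pmult (fps_ptp P) (pmult (fps_ptp P) X Y) Z = pmult (fps_ptp P) X (pmult (fps_ptp P) Y Z)"
      unfolding zips
      by (rule fps_ext, subst fps_bilin_left, rule adds, subst fps_bilin_right, rule adds)
         (simp add: mult_assoc)
    show "pbracket (fps_ptp P) X (pbracket (fps_ptp P) Y Z) +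
        pbracket (fps_ptp P) Y (pbracket (fps_ptp P) Z X) +
        pbracket (fps_ptp P) Z (pbracket (fps_ptp P) X Y) = 0"
      unfolding zips
    proof (rule fps_ext)
      fix n
      let ?X = "fps_nth (fps_zip X)" and ?Y = "fps_nth (fps_zip Y)" and ?Z = "fps_nth (fps_zip Z)"
      let ?b = "pbracket P" and ?T = "{(i, j, k::nat). i + j + k = n}"
      note r = fps_bilin_right[of ?b, OF bracket_add_right]
      have a: "(\<Sum>(i, j, k)\<in>?T. ?b (?Y i) (?b (?Z j) (?X k))) =
          (\<Sum>(i, j, k)\<in>?T. ?b (?Y j) (?b (?Z k) (?X i)))"
        by (rule triple_sum_rotate)
      have b: "(\<Sum>(i, j, k)\<in>?T. ?b (?Z i) (?b (?X j) (?Y k))) =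
          (\<Sum>(i, j, k)\<in>?T. ?b (?Z k) (?b (?X i) (?Y j)))"
        by (rule trans[OF triple_sum_rotate triple_sum_rotate])
      show "fps_nth (fps_bilin ?b (fps_zip X) (fps_bilin ?b (fps_zip Y) (fps_zip Z)) +
          fps_bilin ?b (fps_zip Y) (fps_bilin ?b (fps_zip Z) (fps_zip X)) +
          fps_bilin ?b (fps_zip Z) (fps_bilin ?b (fps_zip X) (fps_zip Y))) n = fps_nth 0 n"
        unfolding fps_add_nth r a b
        by (simp only: sum.distrib[symmetric] case_prod_unfold jacobi sum.neutral_const fps_zero_nth)
    qed
    show "pbracket (fps_ptp P) X (pmult (fps_ptp P) Y Z) =
        pmult (fps_ptp P) (pbracket (fps_ptp P) X Y) Z + pmult (fps_ptp P) Y (pbracket (fps_ptp P) X Z)"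
      unfolding zips
    proof (rule fps_ext)
      fix n
      let ?X = "fps_nth (fps_zip X)" and ?Y = "fps_nth (fps_zip Y)" and ?Z = "fps_nth (fps_zip Z)"
      let ?b = "pbracket P" and ?m = "pmult P" and ?T = "{(i, j, k::nat). i + j + k = n}"
      have a: "(\<Sum>(i, j, k)\<in>?T. ?m (?Y i) (?b (?X j) (?Z k))) =
          (\<Sum>(i, j, k)\<in>?T. ?m (?Y j) (?b (?X i) (?Z k)))"
        by (rule triple_sum_swap)
      show "fps_nth (fps_bilin ?b (fps_zip X) (fps_bilin ?m (fps_zip Y) (fps_zip Z))) n =
          fps_nth (fps_bilin ?m (fps_bilin ?b (fps_zip X) (fps_zip Y)) (fps_zip Z) +
            fps_bilin ?m (fps_zip Y) (fps_bilin ?b (fps_zip X) (fps_zip Z))) n"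
        unfolding fps_add_nth fps_bilin_right[of ?b, OF bracket_add_right]
          fps_bilin_right[of ?m, OF mult_add_right] fps_bilin_left[of ?m, OF mult_add_left] a
        by (simp only: sum.distrib[symmetric] case_prod_unfold leibniz)
    qed
  qed
  then show ?thesis
    using fmods by (simp add: proto_twilled_poisson_def)
qed

definition formal_deformation ::
  "('k::comm_ring_1, 'a::ab_group_add, 'b::ab_group_add) ptp \<Rightarrow> ('b \<Rightarrow> 'a) \<Rightarrow> ('b \<Rightarrow> 'a) fps \<Rightarrow> bool"
  where "formal_deformation P r rt \<longleftrightarrow>
    (\<forall>i. module_hom (scale2 P) (scale1 P) (fps_nth rt i)) \<and>
    fps_nth rt 0 = r \<and>
    deformation_map (fps_ptp P) (fps_lin rt)"

definition infinitesimal :: "('b \<Rightarrow> 'a) fps \<Rightarrow> 'b \<Rightarrow> 'a"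
  where "infinitesimal rt = fps_nth rt 1"

definition equivalent_deformations ::
  "('k::comm_ring_1, 'a::ab_group_add, 'b::ab_group_add) ptp \<Rightarrow> ('b \<Rightarrow> 'a) \<Rightarrow>
    ('b \<Rightarrow> 'a) fps \<Rightarrow> ('b \<Rightarrow> 'a) fps \<Rightarrow> bool"
  where "equivalent_deformations P r rt rt' \<longleftrightarrow>
    (\<exists>x0 \<phi>1 \<phi>2.
      fps_nth \<phi>1 0 = id \<and> fps_nth \<phi>2 0 = id \<and>
      fps_nth \<phi>1 1 = br1 P x0 \<and>
      fps_nth \<phi>2 1 = (\<lambda>u. rho P x0 u + Hmap P x0 (r u)) \<and>
      (\<forall>i\<ge>2. module_hom (scale1 P) (scale1 P) (fps_nth \<phi>1 i)) \<and>
      (\<forall>i\<ge>2. module_hom (scale2 P) (scale2 P) (fps_nth \<phi>2 i)) \<and>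
      deformation_map_hom (fps_ptp P) (fps_lin rt) (fps_lin rt') (fps_lin \<phi>1) (fps_lin \<phi>2))"

end

theory Submission
  imports Defs
begin

text \<open>
  The graph of \<open>r\<close> is the kernel of \<open>(x, u) \<mapsto> x - r u\<close>, and this map sends the product or bracket
  of \<open>(r u, u)\<close> with \<open>(x, 0)\<close> to \<open>(\<nu>\<^sub>r)\<^sub>u x\<close> or \<open>(\<psi>\<^sub>r)\<^sub>u x\<close>. The cocycle conditions are therefore the
  coefficients of \<open>t\<close> in the statement that the graph of \<open>r\<^sub>t\<close> is closed under both operations.
  The coefficient of \<open>t\<close> in \<open>\<phi>\<^sub>1 \<circ> r\<^sub>t = r'\<^sub>t \<circ> \<phi>\<^sub>2\<close> says
  \<open>r\<^sub>1 u - r'\<^sub>1 u = (\<psi>\<^sub>r)\<^sub>u x\<^sub>0 - \<psi>\<^sub>u x\<^sub>0\<close>, which is a coboundary when \<open>\<psi> = 0\<close>.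
\<close>

text \<open>The argument compares coefficients of \<open>1\<close> and \<open>t\<close>; these rules
  expand both, for the operations and for \<open>fps_lin\<close>.\<close>

lemma fps_bilin_nth_0: "fps_nth (fps_bilin f X Y) 0 = f (fps_nth X 0) (fps_nth Y 0)"
  by (simp add: fps_nth_bilin)

lemma fps_bilin_nth_1:
  "fps_nth (fps_bilin f X Y) 1 = f (fps_nth X 0) (fps_nth Y 1) + f (fps_nth X 1) (fps_nth Y 0)"
  by (simp add: fps_nth_bilin)

lemmas fps_lin_nth_0 = fps_bilin_nth_0[of "\<lambda>f x. f x", folded fps_lin_def]
lemmas fps_lin_nth_1 = fps_bilin_nth_1[of "\<lambda>f x. f x", folded fps_lin_def]

lemma fst_nth_fps_unzip: "fps_nth (fst (fps_unzip W)) n = fst (fps_nth W n)"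
  by (simp add: fps_unzip_def)

lemma snd_nth_fps_unzip: "fps_nth (snd (fps_unzip W)) n = snd (fps_nth W n)"
  by (simp add: fps_unzip_def)

text \<open>Stated for an arbitrary \<open>op\<close> so that it serves both the product and the
  bracket. Constant series suffice as arguments, since the cocycle conditions only involve elements
  of \<open>P2\<close>.\<close>

lemma graph_closed_first_order:
  fixes op :: "'a::ab_group_add \<times> 'b::ab_group_add \<Rightarrow> 'a \<times> 'b \<Rightarrow> 'a \<times> 'b"
  assumes zero: "fps_nth R 0 0 = 0"
    and closed: "fps_unzip (fps_bilin op
        (fps_zip (fps_lin R (fps_const u), fps_const u))
        (fps_zip (fps_lin R (fps_const v), fps_const v))) \<in> {(fps_lin R w, w) | w. True}"
  defines "r \<equiv> fps_nth R 0" and "r1 \<equiv> fps_nth R 1"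
  shows "fst (op (r u, u) (r1 v, 0) + op (r1 u, 0) (r v, v)) =
    r (snd (op (r u, u) (r1 v, 0) + op (r1 u, 0) (r v, v))) + r1 (snd (op (r u, u) (r v, v)))"
proof -
  obtain w where w: "fps_unzip (fps_bilin op
        (fps_zip (fps_lin R (fps_const u), fps_const u))
        (fps_zip (fps_lin R (fps_const v), fps_const v))) = (fps_lin R w, w)" (is "?W = _")
    using closed by blast
  note nth = fst_nth_fps_unzip snd_nth_fps_unzip fps_bilin_nth_0 fps_bilin_nth_1
    fps_lin_nth_0 fps_lin_nth_1 fps_nth_zip fst_conv snd_conv
  have c: "fps_nth (fps_const z) 0 = z" "fps_nth (fps_const z) 1 = 0" for z :: 'b
    by simp_all
  \<comment> \<open>The second component determines the two lowest coefficients of \<open>w\<close>,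
    and the first must then be \<open>r w_1 + r1 w_0\<close> in degree one. The assumption
    \<open>zero\<close> removes \<open>r 0\<close>, which comes from the vanishing
    \<open>t\<close>-coefficient of a constant series.\<close>
  have "fps_nth (snd ?W) 0 = fps_nth w 0" "fps_nth (snd ?W) 1 = fps_nth w 1"
    "fps_nth (fst ?W) 1 = fps_nth (fps_lin R w) 1"
    by (simp_all only: w fst_conv snd_conv)
  then show ?thesis
    unfolding nth c zero r_def r1_def by simp
qed

text \<open>Put \<open>v = 0\<close> in \<open>pmult_decomp\<close>: additivity kills every term
  with a zero argument, and the survivors are the terms of \<open>nu_r\<close>.\<close>

lemma nu_r_eq:
  assumes P: "proto_twilled_poisson P"
  shows "nu_r P r u x = fst (pmult P (r u, u) (x, 0)) - r (snd (pmult P (r u, u) (x, 0)))"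
proof -
  interpret poisson_algebra "pscale P" "pmult P" "pbracket P"
    using P by (simp add: proto_twilled_poisson_def)
  have "pmult P z 0 = 0" "pmult P 0 z = 0" for z
    using mult_add_right[of z 0 0] mult_add_left[of 0 0 z] by simp_all
  then have "nu P 0 y = 0" "theta P v 0 = 0" "dot2 P v 0 = 0" "mu P y 0 = 0" for y v
    by (simp_all add: nu_def theta_def dot2_def mu_def flip: zero_prod_def)
  then show ?thesis
    by (simp add: pmult_decomp[OF P] nu_r_def add.commute)
qed

text \<open>As for \<open>nu_r\<close>; the sign of \<open>rho\<close> in \<open>psi_r\<close>
  arises because \<open>x\<close> stands in the second slot of the bracket.\<close>

lemma psi_r_eq:
  assumes P: "proto_twilled_poisson P"
  shows "psi_r P r u x = fst (pbracket P (r u, u) (x, 0)) - r (snd (pbracket P (r u, u) (x, 0)))"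
proof -
  interpret poisson_algebra "pscale P" "pmult P" "pbracket P"
    using P by (simp add: proto_twilled_poisson_def)
  have "pbracket P z 0 = 0" "pbracket P 0 z = 0" for z
    using bracket_add_right[of z 0 0] bracket_add_left[of 0 0 z] by simp_all
  then have "psi P 0 y = 0" "Theta P v 0 = 0" "br2 P v 0 = 0" "rho P y 0 = 0" for y v
    by (simp_all add: psi_def Theta_def br2_def rho_def flip: zero_prod_def)
  then show ?thesis
    by (simp add: pbracket_decomp[OF P] psi_r_def add.commute)
qed

lemma infinitesimal_cocycle:
  assumes P: "proto_twilled_poisson P" and rt: "formal_deformation P r rt"
  shows "infinitesimal rt \<in> cocycles1 P r"
proof -
  interpret poisson_algebra "pscale P" "pmult P" "pbracket P"
    using P by (simp add: proto_twilled_poisson_def)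
  let ?r1 = "fps_nth rt 1"
  have linear: "module_hom (scale2 P) (scale1 P) (fps_nth rt i)" for i
    using rt by (simp add: formal_deformation_def)
  have r: "fps_nth rt 0 = r"
    using rt by (simp add: formal_deformation_def)
  interpret r: module_hom "scale2 P" "scale1 P" r
    using linear[of 0] by (simp add: r)
  have r0: "fps_nth rt 0 0 = 0"
    by (simp add: r r.zero)
  have sub: "poisson_subalgebra (pscale (fps_ptp P)) (pmult (fps_ptp P)) (pbracket (fps_ptp P))
      {(fps_lin rt w, w) | w. True}"
    using rt by (simp add: formal_deformation_def deformation_map_def)
  have graph: "(fps_lin rt w, w) \<in> {(fps_lin rt w, w) | w. True}" for w
    by blast
  have mult: "fst (pmult P (r u, u) (?r1 v, 0) + pmult P (?r1 u, 0) (r v, v)) =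
      r (snd (pmult P (r u, u) (?r1 v, 0) + pmult P (?r1 u, 0) (r v, v)))
      + ?r1 (snd (pmult P (r u, u) (r v, v)))" for u v
  proof (rule graph_closed_first_order[OF r0, unfolded r])
    have "pmult (fps_ptp P) (fps_lin rt (fps_const u), fps_const u)
        (fps_lin rt (fps_const v), fps_const v) \<in> {(fps_lin rt w, w) | w. True}"
      using sub graph unfolding poisson_subalgebra_def by blast
    then show "fps_unzip (fps_bilin (pmult P) (fps_zip (fps_lin rt (fps_const u), fps_const u))
        (fps_zip (fps_lin rt (fps_const v), fps_const v))) \<in> {(fps_lin rt w, w) | w. True}"
      by (simp add: fps_ptp_def)
  qed
  have brk: "fst (pbracket P (r u, u) (?r1 v, 0) + pbracket P (?r1 u, 0) (r v, v)) =
      r (snd (pbracket P (r u, u) (?r1 v, 0) + pbracket P (?r1 u, 0) (r v, v)))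
      + ?r1 (snd (pbracket P (r u, u) (r v, v)))" for u v
  proof (rule graph_closed_first_order[OF r0, unfolded r])
    have "pbracket (fps_ptp P) (fps_lin rt (fps_const u), fps_const u)
        (fps_lin rt (fps_const v), fps_const v) \<in> {(fps_lin rt w, w) | w. True}"
      using sub graph unfolding poisson_subalgebra_def by blast
    then show "fps_unzip (fps_bilin (pbracket P) (fps_zip (fps_lin rt (fps_const u), fps_const u))
        (fps_zip (fps_lin rt (fps_const v), fps_const v))) \<in> {(fps_lin rt w, w) | w. True}"
      by (simp add: fps_ptp_def)
  qed
  have dot: "dot_r P r u v = snd (pmult P (r u, u) (r v, v))"
    and br: "br_r P r u v = snd (pbracket P (r u, u) (r v, v))" for u v
    by (simp_all add: dot_r_def br_r_def pmult_decomp[OF P] pbracket_decomp[OF P])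
  \<comment> \<open>Commutativity moves \<open>(?r1 u, 0)\<close> to the right, so that
    \<open>nu_r_eq\<close> also applies to the second summand of \<open>mult\<close>, with
    \<open>v\<close> for \<open>u\<close>.\<close>
  have "?r1 (dot_r P r u v) = nu_r P r u (?r1 v) + nu_r P r v (?r1 u)" for u v
    using mult[of u v] mult_commute[of "(?r1 u, 0)" "(r v, v)"]
    by (simp add: dot nu_r_eq[OF P] r.add algebra_simps)
  \<comment> \<open>The same exchange in the bracket produces the minus sign of the cocycle
    condition.\<close>
  moreover have "?r1 (br_r P r u v) = psi_r P r u (?r1 v) - psi_r P r v (?r1 u)" for u v
    using brk[of u v] bracket_antisym[of "(?r1 u, 0)" "(r v, v)"]
    by (simp add: br psi_r_eq[OF P] r.add r.neg r.diff algebra_simps)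
  ultimately show ?thesis
    using linear[of 1] by (simp add: cocycles1_def infinitesimal_def)
qed

text \<open>For general \<open>psi\<close> the difference misses being a coboundary by
  \<open>psi P u x\<close>: the degree-one terms of \<open>\<phi>1\<close> and
  \<open>\<phi>2\<close> account only for the \<open>br1\<close>, \<open>rho\<close> and
  \<open>Hmap\<close> parts of \<open>psi_r\<close>.\<close>

lemma infinitesimal_diff_equivalent:
  assumes P: "proto_twilled_poisson P"
    and rt: "formal_deformation P r rt" and rt': "formal_deformation P r rt'"
    and eqv: "equivalent_deformations P r rt rt'"
  shows "\<exists>x. \<forall>u. infinitesimal rt u - infinitesimal rt' u = delta0 P r x u - psi P u x"
proof -
  interpret poisson_algebra "pscale P" "pmult P" "pbracket P"
    using P by (simp add: proto_twilled_poisson_def)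
  have r: "fps_nth rt 0 = r" "fps_nth rt' 0 = r"
    using rt rt' by (simp_all add: formal_deformation_def)
  interpret r: module_hom "scale2 P" "scale1 P" r
    using rt r by (auto simp: formal_deformation_def)
  obtain x \<phi>1 \<phi>2 where \<phi>0: "fps_nth \<phi>1 0 = id" "fps_nth \<phi>2 0 = id"
    and \<phi>1: "fps_nth \<phi>1 1 = br1 P x"
    and \<phi>2: "fps_nth \<phi>2 1 = (\<lambda>u. rho P x u + Hmap P x (r u))"
    and "fps_lin \<phi>1 \<circ> fps_lin rt = fps_lin rt' \<circ> fps_lin \<phi>2"
    using eqv unfolding equivalent_deformations_def deformation_map_hom_def by blast
  then have comm: "fps_lin \<phi>1 (fps_lin rt X) = fps_lin rt' (fps_lin \<phi>2 X)" for X
    by (metis comp_apply)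
  \<comment> \<open>The equivalence has \<open>x\<close> in the first slot, \<open>psi_r\<close> in
    the second.\<close>
  have anti: "br1 P y x = - br1 P x y" "Hmap P y x = - Hmap P x y" for y
    using bracket_antisym[of "(y, 0)" "(x, 0)"] by (simp_all add: br1_def Hmap_def)
  have "infinitesimal rt u - infinitesimal rt' u = delta0 P r x u - psi P u x" for u
  proof -
    have c: "fps_nth (fps_const u) 0 = u" "fps_nth (fps_const u) 1 = 0"
      by simp_all
    have "fps_nth (fps_lin \<phi>1 (fps_lin rt (fps_const u))) 1 =
        fps_nth (fps_lin rt' (fps_lin \<phi>2 (fps_const u))) 1"
      by (simp only: comm)
    then have "fps_nth rt 1 u + br1 P x (r u) =
        r (rho P x u + Hmap P x (r u)) + fps_nth rt' 1 u"
      unfolding fps_lin_nth_0 fps_lin_nth_1 c r \<phi>0 \<phi>1 \<phi>2 by (simp add: r.zero)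
    then show ?thesis
      by (simp add: infinitesimal_def delta0_def psi_r_def anti r.add r.neg r.diff algebra_simps)
  qed
  then show ?thesis by blast
qed

theorem theorem7p4:
  fixes P :: "('k::field_char_0, 'a::ab_group_add, 'b::ab_group_add) ptp"
    and r :: "'b \<Rightarrow> 'a"
  assumes "proto_twilled_poisson P"
    and "deformation_map P r"
  shows "(\<forall>rt. formal_deformation P r rt \<longrightarrow> infinitesimal rt \<in> cocycles1 P r) \<and>
    ((\<forall>u x. psi P u x = 0) \<longrightarrow>
      (\<forall>rt rt'. formal_deformation P r rt \<and> formal_deformation P r rt' \<and>
          equivalent_deformations P r rt rt' \<longrightarrow>
        H1_class P r (infinitesimal rt) \<in> H1_FGV P r \<and>
        H1_class P r (infinitesimal rt') \<in> H1_FGV P r \<and>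
        H1_class P r (infinitesimal rt) = H1_class P r (infinitesimal rt')))"
proof (intro conjI allI impI; (elim conjE)?)
  fix rt assume "formal_deformation P r rt"
  then show "infinitesimal rt \<in> cocycles1 P r"
    by (rule infinitesimal_cocycle[OF assms(1)])
next
  fix rt rt'
  assume psi: "\<forall>u x. psi P u x = 0"
    and rt: "formal_deformation P r rt" and rt': "formal_deformation P r rt'"
    and eqv: "equivalent_deformations P r rt rt'"
  note cocycles = infinitesimal_cocycle[OF assms(1) rt] infinitesimal_cocycle[OF assms(1) rt']
  \<comment> \<open>The class of any cocycle lies in the quotient.\<close>
  show "H1_class P r (infinitesimal rt) \<in> H1_FGV P r"
    "H1_class P r (infinitesimal rt') \<in> H1_FGV P r"
    unfolding H1_class_def H1_FGV_def using cocycles by (simp_all add: quotientI)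
  \<comment> \<open>With \<open>psi = 0\<close> the correction term vanishes, leaving a
    coboundary.\<close>
  obtain x where "infinitesimal rt u - infinitesimal rt' u = delta0 P r x u" for u
    using infinitesimal_diff_equivalent[OF assms(1) rt rt' eqv] psi by auto
  then have "(infinitesimal rt, infinitesimal rt') \<in> cohomologous_rel P r"
    using cocycles by (simp add: cohomologous_rel_def)
  moreover have "equiv (cocycles1 P r) (cohomologous_rel P r)"
    using assms by (intro equiv_cohomologous_rel) (simp_all add: deformation_map_def)
  ultimately show "H1_class P r (infinitesimal rt) = H1_class P r (infinitesimal rt')"
    unfolding H1_class_def by (simp add: equiv_class_eq)
qed

end
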